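(* For each $u,v\in W^J$ there exist a sequence $u=x_0,x_1,\dots,x_n=v$ of elements of $W^J$ and a sequence $i_1,i_2,\dots,i_n\in I_{\mathrm{af}}$ such that for each $0\le k\le n-1$ one has $x_{k+1}=\lfloor s_{i_{k+1}}x_k\rfloor$ and $x_k^{-1}\widetilde\alpha_{i_{k+1}}\in\Phi^+\setminus\Phi_J^+$.
   Context: $\Phi$ is the (irreducible) root system of a finite-dimensional simple Lie algebra with Dynkin node set $I$, simple roots $\alpha_i$, positive roots $\Phi^+$, highest root $\theta$, Weyl group $W$ with simple reflections $r_i$ and reflections $r_\alpha$. $J\subseteq I$, $W_J=\langle r_i:i\in J\rangle$, $\Phi_J^+\subseteq\Phi^+$ the positive roots of its root system, $W^J$ the set of minimum-length coset representatives of $W/W_J$, $\lfloor w\rfloor\in W^J$ the minimum-length representative of $wW_J$. $I_{\mathrm{af}}=I\sqcup\{0\}$; for $i\in I$ put $\widetilde\alpha_i=\alpha_i$, $s_i=r_i$, and put $\widetilde\alpha_0=-\theta$, $s_0=r_\theta$. *)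

theory Defs
  imports "HOL-Analysis.Analysis" "HOL-Algebra.Generated_Groups" "HOL-Algebra.Bij"
begin

text \<open>
  The root system is taken abstractly, as a reduced crystallographic root system spanning a
  Euclidean space.
\<close>

definition reflection :: "'a::euclidean_space \<Rightarrow> 'a \<Rightarrow> 'a" where
  "reflection a x = x - (2 * (x \<bullet> a) / (a \<bullet> a)) *\<^sub>R a"

definition root_system :: "'a::euclidean_space set \<Rightarrow> bool" where
  "root_system \<Phi> \<longleftrightarrow>
     finite \<Phi> \<and> 0 \<notin> \<Phi> \<and> span \<Phi> = UNIV \<and>
     (\<forall>a\<in>\<Phi>. \<forall>c. c *\<^sub>R a \<in> \<Phi> \<longrightarrow> c = 1 \<or> c = -1) \<and>
     (\<forall>a\<in>\<Phi>. reflection a ` \<Phi> = \<Phi>) \<and>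
     (\<forall>a\<in>\<Phi>. \<forall>b\<in>\<Phi>. 2 * (b \<bullet> a) / (a \<bullet> a) \<in> \<int>)"

definition irreducible_root_system :: "'a::euclidean_space set \<Rightarrow> bool" where
  "irreducible_root_system \<Phi> \<longleftrightarrow>
     root_system \<Phi> \<and> \<Phi> \<noteq> {} \<and>
     \<not> (\<exists>A B. A \<noteq> {} \<and> B \<noteq> {} \<and> A \<union> B = \<Phi> \<and> A \<inter> B = {} \<and> (\<forall>a\<in>A. \<forall>b\<in>B. a \<bullet> b = 0))"

text \<open>The cone of nonnegative integral combinations of the simple roots.\<close>

definition root_cone :: "'i set \<Rightarrow> ('i \<Rightarrow> 'a::euclidean_space) \<Rightarrow> 'a set" where
  "root_cone I \<alpha> = {\<Sum>i\<in>I. of_nat (c i) *\<^sub>R \<alpha> i | c :: 'i \<Rightarrow> nat. True}"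

text \<open>\<open>\<alpha>\<close> enumerates, without repetition, a base of \<open>\<Phi>\<close> by the node set \<open>I\<close>.\<close>

definition simple_roots :: "'a::euclidean_space set \<Rightarrow> 'i set \<Rightarrow> ('i \<Rightarrow> 'a) \<Rightarrow> bool" where
  "simple_roots \<Phi> I \<alpha> \<longleftrightarrow>
     finite I \<and> inj_on \<alpha> I \<and> \<alpha> ` I \<subseteq> \<Phi> \<and>
     independent (\<alpha> ` I) \<and> span (\<alpha> ` I) = UNIV \<and>
     (\<forall>b\<in>\<Phi>. b \<in> root_cone I \<alpha> \<or> - b \<in> root_cone I \<alpha>)"

definition positive_roots :: "'a::euclidean_space set \<Rightarrow> 'i set \<Rightarrow> ('i \<Rightarrow> 'a) \<Rightarrow> 'a set" where
  "positive_roots \<Phi> I \<alpha> = \<Phi> \<inter> root_cone I \<alpha>"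

text \<open>The root system of \<open>W\<^sub>J\<close> is \<open>\<Phi>\<^sub>J = \<Phi> \<inter> span {\<alpha>\<^sub>j | j \<in> J}\<close>.\<close>

definition positive_roots_sub ::
  "'a::euclidean_space set \<Rightarrow> 'i set \<Rightarrow> ('i \<Rightarrow> 'a) \<Rightarrow> 'i set \<Rightarrow> 'a set" where
  "positive_roots_sub \<Phi> I \<alpha> J = positive_roots \<Phi> I \<alpha> \<inter> span (\<alpha> ` J)"

definition highest_root :: "'a::euclidean_space set \<Rightarrow> 'i set \<Rightarrow> ('i \<Rightarrow> 'a) \<Rightarrow> 'a \<Rightarrow> bool" where
  "highest_root \<Phi> I \<alpha> \<theta> \<longleftrightarrow> \<theta> \<in> \<Phi> \<and> (\<forall>b\<in>\<Phi>. \<theta> - b \<in> root_cone I \<alpha>)"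

text \<open>
  Weyl group elements are the linear maps themselves, acting on roots by application and
  multiplied by composition. \<open>weyl \<alpha> J\<close> is \<open>W\<^sub>J\<close>; the whole Weyl group is \<open>weyl \<alpha> I\<close>.
\<close>

definition weyl :: "('i \<Rightarrow> 'a::euclidean_space) \<Rightarrow> 'i set \<Rightarrow> ('a \<Rightarrow> 'a) set" where
  "weyl \<alpha> J = generate (BijGroup UNIV) ((\<lambda>j. reflection (\<alpha> j)) ` J)"

definition weyl_word :: "('i \<Rightarrow> 'a::euclidean_space) \<Rightarrow> 'i list \<Rightarrow> 'a \<Rightarrow> 'a" where
  "weyl_word \<alpha> js = foldr (\<lambda>j w. reflection (\<alpha> j) \<circ> w) js id"

definition weyl_length :: "('i \<Rightarrow> 'a::euclidean_space) \<Rightarrow> 'i set \<Rightarrow> ('a \<Rightarrow> 'a) \<Rightarrow> nat" where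
  "weyl_length \<alpha> I w = (LEAST n. \<exists>js. length js = n \<and> set js \<subseteq> I \<and> weyl_word \<alpha> js = w)"

definition weyl_coset :: "('i \<Rightarrow> 'a::euclidean_space) \<Rightarrow> 'i set \<Rightarrow> ('a \<Rightarrow> 'a) \<Rightarrow> ('a \<Rightarrow> 'a) set" where
  "weyl_coset \<alpha> J w = (\<lambda>y. w \<circ> y) ` weyl \<alpha> J"

definition min_reps :: "('i \<Rightarrow> 'a::euclidean_space) \<Rightarrow> 'i set \<Rightarrow> 'i set \<Rightarrow> ('a \<Rightarrow> 'a) set" where
  "min_reps \<alpha> I J =
     {w \<in> weyl \<alpha> I. \<forall>y\<in>weyl_coset \<alpha> J w. weyl_length \<alpha> I w \<le> weyl_length \<alpha> I y}"

definition min_rep ::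
  "('i \<Rightarrow> 'a::euclidean_space) \<Rightarrow> 'i set \<Rightarrow> 'i set \<Rightarrow> ('a \<Rightarrow> 'a) \<Rightarrow> ('a \<Rightarrow> 'a)" where
  "min_rep \<alpha> I J w = (THE x. x \<in> min_reps \<alpha> I J \<and> x \<in> weyl_coset \<alpha> J w)"

text \<open>The affine node \<open>0\<close> is encoded as \<^const>\<open>None\<close>, a node \<open>i \<in> I\<close> as \<open>Some i\<close>.\<close>

definition affine_nodes :: "'i set \<Rightarrow> 'i option set" where
  "affine_nodes I = insert None (Some ` I)"

definition affine_root :: "('i \<Rightarrow> 'a::euclidean_space) \<Rightarrow> 'a \<Rightarrow> 'i option \<Rightarrow> 'a" where
  "affine_root \<alpha> \<theta> p = (case p of None \<Rightarrow> - \<theta> | Some i \<Rightarrow> \<alpha> i)"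

definition affine_reflection ::
  "('i \<Rightarrow> 'a::euclidean_space) \<Rightarrow> 'a \<Rightarrow> 'i option \<Rightarrow> 'a \<Rightarrow> 'a" where
  "affine_reflection \<alpha> \<theta> p =
     (case p of None \<Rightarrow> reflection \<theta> | Some i \<Rightarrow> reflection (\<alpha> i))"

end

theory Submission
  imports Defs
begin

text \<open>
  Let \<open>\<lambda>\<close> be the sum of the vectors dual to the simple roots outside \<open>J\<close>. It is dominant and
  fixed by \<open>W\<^sub>J\<close>, so \<open>x \<mapsto> x \<lambda>\<close> turns a minimal representative into a weight, and a
  root \<open>\<beta>\<close> with \<open>\<langle>\<lambda>, \<beta>\<rangle> > 0\<close> is positive and does not lie in \<open>\<Phi>\<^sub>J\<close>. Since
  \<open>\<langle>\<lambda>, x\<^sup>-\<^sup>1 \<alpha>\<^sub>i\<rangle> = \<langle>x \<lambda>, \<alpha>\<^sub>i\<rangle>\<close> (with \<open>\<alpha>\<^sub>0 = - \<theta>\<close>), a step from \<open>x\<close> along the affine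
  node \<open>i\<close> is certainly allowed when \<open>\<langle>x \<lambda>, \<alpha>\<^sub>i\<rangle> > 0\<close>; call the result \<open>T\<^sub>i x = \<lfloor>s\<^sub>i x\<rfloor>\<close>.

  Let \<open>S\<close> be the set of representatives that can be reached from \<open>u\<close>. It suffices that \<open>S\<close> is
  everything, and this follows by averaging. For a fixed node \<open>i\<close> the map \<open>T\<^sub>i\<close> is an involution
  that negates \<open>\<langle>x \<lambda>, \<alpha>\<^sub>i\<rangle>\<close>, and it sends the elements of \<open>S\<close> with positive pairing
  into \<open>S\<close>. So the positive values are cancelled, and \<open>\<sigma> = \<Sum>\<^sub>x\<^sub>\<in>\<^sub>S x \<lambda>\<close> satisfies
  \<open>\<langle>\<sigma>, \<alpha>\<^sub>i\<rangle> \<le> 0\<close> for every affine node (\<open>involution_sum\<close>). For \<open>i = 0\<close> this reads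
  \<open>\<langle>\<sigma>, \<theta>\<rangle> \<ge> 0\<close>, while \<open>\<theta>\<close> is a combination of the simple roots with strictly positive
  coefficients; hence \<open>\<langle>\<sigma>, \<alpha>\<^sub>i\<rangle> = 0\<close> for all \<open>i\<close>. Equality in the averaging argument
  means that \<open>S\<close> is also closed under \<open>T\<^sub>i\<close> at elements with negative pairing, and at elements
  with zero pairing \<open>T\<^sub>i\<close> is the identity. Thus \<open>S\<close> is closed under all \<open>T\<^sub>i\<close>, and as \<open>W\<close> is
  generated by the simple reflections, \<open>S = W\<^sup>J\<close> (\<open>out_closed_eq_all\<close>).

  The facts on Weyl groups behind this are derived from the definitions: the exchange property
  for words (\<open>exchange\<close>), which makes the minimal representative of a coset unique
  (\<open>min_reps_unique\<close>), and the fact that the reflection in a root of \<open>\<Phi>\<^sub>J\<close> belongs to \<open>W\<^sub>J\<close>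
  (\<open>reflection_in_parabolic\<close>), which is needed both for \<open>r\<^sub>\<theta> \<in> W\<close> and for the case of zero
  pairing.
\<close>

section \<open>Reflections and words of reflections\<close>

lemma reflection_self: "a \<noteq> 0 \<Longrightarrow> reflection a a = - a"
  by (simp add: reflection_def algebra_simps) (simp add: scaleR_2)

lemma linear_reflection: "linear (reflection a)"
  unfolding reflection_def
  by (rule linearI)
     (auto simp: inner_add_left algebra_simps add_divide_distrib)

lemma reflection_reflection [simp]: "reflection a (reflection a x) = x"
  by (cases "a = 0") (auto simp: reflection_def inner_diff_left algebra_simps)

lemma reflection_comp_self [simp]: "reflection a \<circ> reflection a = id"
  by (rule ext) simp

lemma reflection_inner: "reflection a x \<bullet> reflection a y = x \<bullet> y"
  by (cases "a = 0")
     (auto simp: reflection_def inner_diff_left inner_diff_right inner_commute algebra_simps)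

lemma reflection_inner_swap: "reflection a x \<bullet> y = x \<bullet> reflection a y"
  by (metis reflection_inner reflection_reflection)

lemma reflection_uminus [simp]: "reflection (- a) = reflection a"
  by (rule ext) (simp add: reflection_def)

lemma reflection_fixes: "x \<bullet> a = 0 \<Longrightarrow> reflection a x = x"
  by (simp add: reflection_def)

lemma bij_reflection: "bij (reflection a)"
  by (rule o_bij[of "reflection a"]) auto

lemma reflection_conjugate:
  assumes "linear w" "\<And>x y. w x \<bullet> w y = x \<bullet> y"
  shows "w \<circ> reflection a = reflection (w a) \<circ> w"
  by (rule ext) (simp add: reflection_def linear_diff[OF assms(1)] linear_scale[OF assms(1)] assms(2))

lemma weyl_word_Nil [simp]: "weyl_word \<alpha> [] = id"
  by (simp add: weyl_word_def)

lemma weyl_word_Cons [simp]: "weyl_word \<alpha> (j # js) = reflection (\<alpha> j) \<circ> weyl_word \<alpha> js"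
  by (simp add: weyl_word_def)

lemma weyl_word_append: "weyl_word \<alpha> (js @ ks) = weyl_word \<alpha> js \<circ> weyl_word \<alpha> ks"
  by (induction js) (auto simp: comp_assoc)

lemma linear_weyl_word: "linear (weyl_word \<alpha> js)"
proof (induction js)
  case Nil
  show ?case unfolding weyl_word_Nil by (rule linear_id)
next
  case (Cons j js)
  then show ?case unfolding weyl_word_Cons by (rule linear_compose) (rule linear_reflection)
qed

lemma weyl_word_inner: "weyl_word \<alpha> js x \<bullet> weyl_word \<alpha> js y = x \<bullet> y"
  by (induction js) (auto simp: reflection_inner)

lemma bij_weyl_word: "bij (weyl_word \<alpha> js)"
proof (induction js)
  case Nil
  show ?case unfolding weyl_word_Nil by (rule bij_id)
next
  case (Cons j js)
  then show ?case unfolding weyl_word_Cons by (rule bij_comp) (rule bij_reflection)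
qed

lemma weyl_word_rev: "weyl_word \<alpha> (rev js) \<circ> weyl_word \<alpha> js = id"
proof
  show "(weyl_word \<alpha> (rev js) \<circ> weyl_word \<alpha> js) x = id x" for x
    by (induction js) (simp_all add: weyl_word_append)
qed

text \<open>
  The generators are involutions, so the inverses in the generated group add nothing to the words.
\<close>

lemma weyl_eq_words:
  fixes \<alpha> :: "'i \<Rightarrow> 'b::euclidean_space"
  shows "weyl \<alpha> J = {weyl_word \<alpha> js | js. set js \<subseteq> J}"
proof -
  interpret G: group "BijGroup (UNIV :: 'b set)" by (rule group_BijGroup)
  have carr: "f \<in> carrier (BijGroup UNIV) \<longleftrightarrow> bij f" for f :: "'b \<Rightarrow> 'b"
    by (auto simp: BijGroup_def Bij_def)
  have mul: "f \<otimes>\<^bsub>BijGroup UNIV\<^esub> g = f \<circ> g" if "bij f" "bij g" for f g :: "'b \<Rightarrow> 'b"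
    using that by (auto simp: BijGroup_def Bij_def compose_def fun_eq_iff)
  have unit: "\<one>\<^bsub>BijGroup UNIV\<^esub> = (id :: 'b \<Rightarrow> 'b)"
    by (auto simp: BijGroup_def fun_eq_iff)
  have inverse: "inv\<^bsub>BijGroup UNIV\<^esub> (reflection a) = reflection a" for a :: 'b
    by (rule G.inv_equality) (auto simp: carr mul unit bij_reflection)
  have "w \<in> {weyl_word \<alpha> js | js. set js \<subseteq> J}" if "w \<in> weyl \<alpha> J" for w
    using that unfolding weyl_def
  proof (induction rule: generate.induct)
    case one
    have "id = weyl_word \<alpha> []" by simp
    then show ?case unfolding unit by (metis (mono_tags) mem_Collect_eq empty_subsetI list.set(1))
  next
    case (incl h)
    then obtain j where "j \<in> J" "h = reflection (\<alpha> j)" by auto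
    then show ?case by (auto intro: exI[of _ "[j]"])
  next
    case (inv h)
    then obtain j where "j \<in> J" "h = reflection (\<alpha> j)" by auto
    then show ?case by (auto simp: inverse intro: exI[of _ "[j]"])
  next
    case (eng h k)
    then obtain js ks where "h = weyl_word \<alpha> js" "k = weyl_word \<alpha> ks" "set js \<subseteq> J" "set ks \<subseteq> J"
      by auto
    then show ?case
      by (auto simp: mul bij_weyl_word weyl_word_append intro!: exI[of _ "js @ ks"])
  qed
  moreover have "weyl_word \<alpha> js \<in> weyl \<alpha> J" if "set js \<subseteq> J" for js
    using that
  proof (induction js)
    case Nil
    show ?case unfolding weyl_def weyl_word_Nil unit[symmetric] by (rule generate.one)
  next
    case (Cons j js)
    then have "reflection (\<alpha> j) \<in> weyl \<alpha> J" "weyl_word \<alpha> js \<in> weyl \<alpha> J"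
      unfolding weyl_def by (auto intro: generate.incl)
    then have "reflection (\<alpha> j) \<otimes>\<^bsub>BijGroup UNIV\<^esub> weyl_word \<alpha> js \<in> weyl \<alpha> J"
      unfolding weyl_def by (rule generate.eng)
    then show ?case unfolding mul[OF bij_reflection bij_weyl_word] weyl_word_Cons .
  qed
  ultimately show ?thesis by blast
qed

lemma weyl_word_in_weyl: "set js \<subseteq> J \<Longrightarrow> weyl_word \<alpha> js \<in> weyl \<alpha> J"
  by (auto simp: weyl_eq_words)

lemma weylE:
  assumes "w \<in> weyl \<alpha> J"
  obtains js where "set js \<subseteq> J" "w = weyl_word \<alpha> js"
  using assms by (auto simp: weyl_eq_words)

lemma id_in_weyl: "id \<in> weyl \<alpha> J"
  using weyl_word_in_weyl[of "[]"] by simp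

lemma simple_reflection_in_weyl: "j \<in> J \<Longrightarrow> reflection (\<alpha> j) \<in> weyl \<alpha> J"
  using weyl_word_in_weyl[of "[j]" J \<alpha>] by simp

lemma weyl_comp:
  assumes "v \<in> weyl \<alpha> J" "w \<in> weyl \<alpha> J"
  shows "v \<circ> w \<in> weyl \<alpha> J"
proof -
  obtain js ks where "set (js @ ks) \<subseteq> J" "v = weyl_word \<alpha> js" "w = weyl_word \<alpha> ks"
    using assms by (auto elim!: weylE)
  then show ?thesis using weyl_word_in_weyl[of "js @ ks" J \<alpha>] by (simp only: weyl_word_append)
qed

lemma weyl_mono: "J \<subseteq> I \<Longrightarrow> w \<in> weyl \<alpha> J \<Longrightarrow> w \<in> weyl \<alpha> I"
  by (auto simp: weyl_eq_words)

lemma linear_weyl: "w \<in> weyl \<alpha> J \<Longrightarrow> linear w"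
  by (auto elim!: weylE simp only: linear_weyl_word)

lemma weyl_inner: "w \<in> weyl \<alpha> J \<Longrightarrow> w x \<bullet> w y = x \<bullet> y"
  by (auto elim!: weylE simp only: weyl_word_inner)

lemma bij_weyl: "w \<in> weyl \<alpha> J \<Longrightarrow> bij w"
  by (auto elim!: weylE simp only: bij_weyl_word)

lemma inv_in_weyl:
  assumes "w \<in> weyl \<alpha> J"
  shows "inv_into UNIV w \<in> weyl \<alpha> J"
proof -
  obtain js where js: "set js \<subseteq> J" "w = weyl_word \<alpha> js" using assms by (rule weylE)
  then have "inv_into UNIV w = weyl_word \<alpha> (rev js)"
    using inv_unique_comp[of w "weyl_word \<alpha> (rev js)"] weyl_word_rev[of \<alpha> js]
      weyl_word_rev[of \<alpha> "rev js"] by simp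
  then show ?thesis using js(1) weyl_word_in_weyl[of "rev js" J \<alpha>] by simp
qed

lemma weyl_comp_inv:
  "w \<in> weyl \<alpha> J \<Longrightarrow> w \<circ> inv_into UNIV w = id"
  "w \<in> weyl \<alpha> J \<Longrightarrow> inv_into UNIV w \<circ> w = id"
  by (metis bij_weyl bij_is_surj surj_iff) (metis bij_weyl bij_is_inj inv_o_cancel)

lemma weyl_fixes:
  assumes "w \<in> weyl \<alpha> J" "\<And>j. j \<in> J \<Longrightarrow> x \<bullet> \<alpha> j = 0"
  shows "w x = x"
proof -
  have "weyl_word \<alpha> js x = x" if "set js \<subseteq> J" for js
    using that by (induction js) (auto simp: reflection_fixes assms(2))
  then show ?thesis using assms(1) by (auto elim!: weylE)
qed

section \<open>Cosets of a parabolic subgroup\<close>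

lemma self_in_weyl_coset: "w \<in> weyl_coset \<alpha> J w"
  unfolding weyl_coset_def by (rule image_eqI[of _ _ id]) (simp_all only: comp_id id_in_weyl)

lemma weyl_coset_subset:
  assumes "y \<in> weyl_coset \<alpha> J w"
  shows "weyl_coset \<alpha> J y \<subseteq> weyl_coset \<alpha> J w"
proof
  fix x assume "x \<in> weyl_coset \<alpha> J y"
  then obtain z z' where "z \<in> weyl \<alpha> J" "z' \<in> weyl \<alpha> J" "x = w \<circ> (z \<circ> z')"
    using assms by (auto simp: weyl_coset_def comp_assoc)
  then show "x \<in> weyl_coset \<alpha> J w" unfolding weyl_coset_def using weyl_comp by blast
qed

lemma weyl_coset_eq:
  assumes "y \<in> weyl_coset \<alpha> J w"
  shows "weyl_coset \<alpha> J y = weyl_coset \<alpha> J w"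
proof -
  obtain z where z: "z \<in> weyl \<alpha> J" "y = w \<circ> z" using assms by (auto simp: weyl_coset_def)
  then have "w = y \<circ> inv_into UNIV z"
    using weyl_comp_inv(1)[OF z(1)] by (metis comp_assoc comp_id)
  then have "w \<in> weyl_coset \<alpha> J y"
    unfolding weyl_coset_def using inv_in_weyl[OF z(1)] by blast
  then show ?thesis using assms weyl_coset_subset by blast
qed

lemma weyl_coset_left_mult:
  "y \<in> weyl_coset \<alpha> J w \<Longrightarrow> s \<circ> y \<in> weyl_coset \<alpha> J (s \<circ> w)"
  unfolding weyl_coset_def by (metis (no_types, lifting) comp_assoc image_iff)

lemma weyl_coset_in_weyl:
  "J \<subseteq> I \<Longrightarrow> w \<in> weyl \<alpha> I \<Longrightarrow> y \<in> weyl_coset \<alpha> J w \<Longrightarrow> y \<in> weyl \<alpha> I"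
  unfolding weyl_coset_def by (auto intro: weyl_comp weyl_mono)

lemma weyl_length_le: "set js \<subseteq> I \<Longrightarrow> weyl_length \<alpha> I (weyl_word \<alpha> js) \<le> length js"
  unfolding weyl_length_def by (rule Least_le) auto

lemma reduced_wordE:
  assumes "w \<in> weyl \<alpha> I"
  obtains js where "length js = weyl_length \<alpha> I w" "set js \<subseteq> I" "weyl_word \<alpha> js = w"
proof -
  have "\<exists>n js. length js = n \<and> set js \<subseteq> I \<and> weyl_word \<alpha> js = w"
    using assms by (auto simp: weyl_eq_words)
  from LeastI_ex[OF this] show ?thesis using that unfolding weyl_length_def by blast
qed

section \<open>Roots and their coordinates\<close>

locale based_root_system =
  fixes \<Phi> :: "'a::euclidean_space set" and I :: "'i set" and \<alpha> :: "'i \<Rightarrow> 'a"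
  assumes root_system: "root_system \<Phi>" and simple_roots: "simple_roots \<Phi> I \<alpha>"
begin

lemma finite_I: "finite I" and simple_root: "i \<in> I \<Longrightarrow> \<alpha> i \<in> \<Phi>"
  and finite_roots: "finite \<Phi>" and zero_not_root: "0 \<notin> \<Phi>"
  using root_system simple_roots by (auto simp: root_system_def simple_roots_def)

lemma reflection_root: "a \<in> \<Phi> \<Longrightarrow> b \<in> \<Phi> \<Longrightarrow> reflection a b \<in> \<Phi>"
  using root_system unfolding root_system_def by blast

lemma uminus_root: "b \<in> \<Phi> \<Longrightarrow> - b \<in> \<Phi>"
  using reflection_root[of b b] reflection_self[of b] zero_not_root by metis

lemma weyl_root: "w \<in> weyl \<alpha> I \<Longrightarrow> b \<in> \<Phi> \<Longrightarrow> w b \<in> \<Phi>"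
proof -
  assume b: "b \<in> \<Phi>" and w: "w \<in> weyl \<alpha> I"
  have "weyl_word \<alpha> js b \<in> \<Phi>" if "set js \<subseteq> I" for js
    using that by (induction js) (auto simp: b reflection_root simple_root)
  then show ?thesis using w by (auto elim!: weylE)
qed

text \<open>
  The basis dual to the simple roots with respect to the inner product. The dual vector of \<open>i\<close>
  reads off the coefficient at \<open>\<alpha>\<^sub>i\<close>, so positivity of roots becomes a sign condition on
  inner products. Up to scaling these are the fundamental weights.
\<close>

definition dual :: "'i \<Rightarrow> 'a" where
  "dual i = (SOME d. \<forall>k\<in>I. d \<bullet> \<alpha> k = (if k = i then 1 else 0))"

lemma dual_simple:
  assumes "k \<in> I"
  shows "dual i \<bullet> \<alpha> k = (if k = i then 1 else 0)"
proof -
  have "independent (\<alpha> ` I)" "inj_on \<alpha> I" using simple_roots by (auto simp: simple_roots_def)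
  then obtain g :: "'a \<Rightarrow> real"
    where g: "linear g" "\<forall>x\<in>\<alpha> ` I. g x = (if inv_into I \<alpha> x = i then 1 else 0)"
    using linear_independent_extend[of "\<alpha> ` I" "\<lambda>x. if inv_into I \<alpha> x = i then 1 else 0"] by auto
  have "adjoint g 1 \<bullet> x = g x" for x
    using adjoint_works[OF g(1), of x 1] by (simp add: inner_commute)
  then have "\<forall>k\<in>I. adjoint g 1 \<bullet> \<alpha> k = (if k = i then 1 else 0)"
    using g(2) \<open>inj_on \<alpha> I\<close> by auto
  then have "\<forall>k\<in>I. dual i \<bullet> \<alpha> k = (if k = i then 1 else 0)"
    unfolding dual_def by (rule someI)
  then show ?thesis using assms by blast
qed

lemma expansion: "x = (\<Sum>i\<in>I. (dual i \<bullet> x) *\<^sub>R \<alpha> i)"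
proof -
  have lin: "linear (\<lambda>x. \<Sum>i\<in>I. (dual i \<bullet> x) *\<^sub>R \<alpha> i)"
    by (rule linearI) (auto simp: inner_add_right sum.distrib scaleR_add_left scaleR_sum_right)
  have "id x = (\<Sum>i\<in>I. (dual i \<bullet> x) *\<^sub>R \<alpha> i)"
  proof (rule linear_eq_on_span[OF linear_id lin])
    show "x \<in> span (\<alpha> ` I)" using simple_roots by (simp add: simple_roots_def)
    fix y assume "y \<in> \<alpha> ` I"
    then obtain k where "k \<in> I" "y = \<alpha> k" by auto
    then show "id y = (\<Sum>i\<in>I. (dual i \<bullet> y) *\<^sub>R \<alpha> i)"
      by (simp add: dual_simple if_distrib[of "\<lambda>c. c *\<^sub>R _"] sum.delta finite_I cong: if_cong)
  qed
  then show ?thesis by simp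
qed

lemma dual_cone: "x \<in> root_cone I \<alpha> \<Longrightarrow> i \<in> I \<Longrightarrow> dual i \<bullet> x \<ge> 0"
  by (auto simp: root_cone_def inner_sum_right dual_simple intro!: sum_nonneg)

abbreviation "P \<equiv> positive_roots \<Phi> I \<alpha>"

lemma positive_root: "b \<in> P \<Longrightarrow> b \<in> \<Phi>"
  by (simp add: positive_roots_def)

lemma dual_positive: "b \<in> P \<Longrightarrow> i \<in> I \<Longrightarrow> dual i \<bullet> b \<ge> 0"
  by (simp add: positive_roots_def dual_cone)

lemma positive_or_negative: "b \<in> \<Phi> \<Longrightarrow> b \<in> P \<or> - b \<in> P"
  using simple_roots uminus_root by (auto simp: simple_roots_def positive_roots_def)

lemma dual_nonzero: "b \<in> \<Phi> \<Longrightarrow> \<exists>i\<in>I. dual i \<bullet> b \<noteq> 0"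
  using expansion[of b] zero_not_root by (metis (no_types, lifting) scaleR_zero_left sum.neutral)

text \<open>The coefficients of a root all have the same sign, so one of them decides.\<close>

lemma positiveI: "b \<in> \<Phi> \<Longrightarrow> i \<in> I \<Longrightarrow> dual i \<bullet> b > 0 \<Longrightarrow> b \<in> P"
  using positive_or_negative[of b] dual_positive[of "- b" i] by auto

lemma not_positive_and_negative: "b \<in> P \<Longrightarrow> - b \<notin> P"
  using dual_nonzero[of b] dual_positive[of b] dual_positive[of "- b"] positive_root[of b] by force

lemma positiveI_nonneg: "b \<in> \<Phi> \<Longrightarrow> (\<And>i. i \<in> I \<Longrightarrow> dual i \<bullet> b \<ge> 0) \<Longrightarrow> b \<in> P"
  using dual_nonzero[of b] positiveI[of b] by force

lemma simple_positive: "i \<in> I \<Longrightarrow> \<alpha> i \<in> P"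
  by (rule positiveI_nonneg) (auto simp: simple_root dual_simple)

lemma dual_reflection:
  "j \<in> I \<Longrightarrow> j \<noteq> k \<Longrightarrow> dual k \<bullet> reflection (\<alpha> j) x = dual k \<bullet> x"
  by (simp add: reflection_def inner_diff_right dual_simple)

text \<open>
  Reducedness of the root system provides a coefficient at some \<open>k \<noteq> i\<close> that does not vanish. The
  reflection changes only the coefficient at \<open>i\<close>, so this positive one survives.
\<close>

lemma simple_reflection_positive:
  assumes "i \<in> I" "b \<in> P" "b \<noteq> \<alpha> i"
  shows "reflection (\<alpha> i) b \<in> P"
proof -
  have "\<exists>k\<in>I. k \<noteq> i \<and> dual k \<bullet> b \<noteq> 0"
  proof (rule ccontr)
    assume "\<not> ?thesis"
    then have "(\<Sum>k\<in>I. (dual k \<bullet> b) *\<^sub>R \<alpha> k) = (\<Sum>k\<in>I. if k = i then (dual i \<bullet> b) *\<^sub>R \<alpha> i else 0)"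
      by (intro sum.cong) auto
    then have b: "b = (dual i \<bullet> b) *\<^sub>R \<alpha> i"
      using expansion[of b] assms(1) finite_I by simp
    have "\<forall>c. c *\<^sub>R \<alpha> i \<in> \<Phi> \<longrightarrow> c = 1 \<or> c = -1"
      using root_system simple_root[OF assms(1)] by (auto simp: root_system_def)
    then have "dual i \<bullet> b = 1 \<or> dual i \<bullet> b = -1"
      using b positive_root[OF assms(2)] by metis
    moreover have "dual i \<bullet> b \<ge> 0" using dual_positive assms by blast
    ultimately show False using b assms(3) by auto
  qed
  then obtain k where k: "k \<in> I" "k \<noteq> i" "dual k \<bullet> b \<noteq> 0" by blast
  then have "dual k \<bullet> reflection (\<alpha> i) b > 0"
    using dual_reflection[of i k b] assms dual_positive[of b k] by auto
  then show ?thesis using k assms positiveI reflection_root simple_root positive_root by blast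
qed

section \<open>Exchange, and uniqueness of minimal representatives\<close>

text \<open>
  Apply the letters of \<open>js\<close> to \<open>\<alpha>\<^sub>j\<close> from right to left. Some letter \<open>i\<close> turns the
  positive root \<open>w \<alpha>\<^sub>j\<close> obtained so far into a negative one, which forces \<open>w \<alpha>\<^sub>j = \<alpha>\<^sub>i\<close>. Then
  \<open>w r\<^sub>j = r\<^sub>i w\<close>, and multiplying by \<open>r\<^sub>j\<close> on the right deletes that letter.
\<close>

lemma exchange:
  assumes "set js \<subseteq> I" "j \<in> I" "- weyl_word \<alpha> js (\<alpha> j) \<in> P"
  shows "\<exists>ks. length js = Suc (length ks) \<and> set ks \<subseteq> set js \<and>
              weyl_word \<alpha> ks = weyl_word \<alpha> js \<circ> reflection (\<alpha> j)"
  using assms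
proof (induction js)
  case Nil
  then show ?case using simple_positive not_positive_and_negative by auto
next
  case (Cons i js)
  let ?w = "weyl_word \<alpha> js"
  have i: "i \<in> I" "set js \<subseteq> I" using Cons.prems by auto
  show ?case
  proof (cases "- ?w (\<alpha> j) \<in> P")
    case True
    then obtain ks where ks: "length js = Suc (length ks)" "set ks \<subseteq> set js"
        "weyl_word \<alpha> ks = ?w \<circ> reflection (\<alpha> j)"
      using Cons.IH[OF i(2) Cons.prems(2) True] by blast
    show ?thesis by (rule exI[of _ "i # ks"]) (use ks in \<open>auto simp: comp_assoc\<close>)
  next
    case False
    have "?w (\<alpha> j) \<in> \<Phi>"
      using weyl_root[OF weyl_word_in_weyl[OF i(2)]] simple_root Cons.prems(2) by blast
    then have "?w (\<alpha> j) \<in> P" using False positive_or_negative by blast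
    moreover have "reflection (\<alpha> i) (?w (\<alpha> j)) \<notin> P"
      using Cons.prems(3) not_positive_and_negative by auto
    ultimately have eq: "?w (\<alpha> j) = \<alpha> i" using simple_reflection_positive i(1) by blast
    have "?w \<circ> reflection (\<alpha> j) = reflection (\<alpha> i) \<circ> ?w"
      using reflection_conjugate[OF linear_weyl_word weyl_word_inner, of \<alpha> js "\<alpha> j"] eq by simp
    then have "weyl_word \<alpha> (i # js) \<circ> reflection (\<alpha> j) = ?w"
      by (metis comp_assoc id_comp reflection_comp_self weyl_word_Cons)
    then show ?thesis
      by (intro exI[of _ js] conjI) (simp_all only: length_Cons list.set subset_insertI)
  qed
qed

text \<open>
  A shortest word for \<open>z\<close> over \<open>J\<close>, if not empty, has a last letter \<open>j\<close> with \<open>z \<alpha>\<^sub>j\<close> positive.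
  The word without that letter sends \<open>\<alpha>\<^sub>j\<close> to a negative root, and the exchange property
  yields a still shorter word for \<open>z\<close>. Deleting a letter keeps the word over \<open>J\<close>, so it contradicts minimality.
\<close>

lemma positive_imp_id:
  assumes "J \<subseteq> I" "z \<in> weyl \<alpha> J" "\<And>j. j \<in> J \<Longrightarrow> z (\<alpha> j) \<in> P"
  shows "z = id"
proof -
  let ?Q = "\<lambda>js. set js \<subseteq> J \<and> weyl_word \<alpha> js = z"
  obtain js0 where "?Q js0" using assms(2) by (auto elim!: weylE)
  then obtain js where js: "?Q js" "\<And>ks. ?Q ks \<Longrightarrow> length js \<le> length ks"
    using ex_has_least_nat[of ?Q js0 length] by blast
  show ?thesis
  proof (cases js rule: rev_cases)
    case Nil
    then show ?thesis using js by auto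
  next
    case (snoc ks j)
    then have j: "j \<in> J" "set ks \<subseteq> J" and z: "z = weyl_word \<alpha> ks \<circ> reflection (\<alpha> j)"
      using js(1) by (auto simp: weyl_word_append)
    have "j \<in> I" using j assms(1) by auto
    then have "\<alpha> j \<noteq> 0" using simple_root zero_not_root by metis
    then have "z (\<alpha> j) = - weyl_word \<alpha> ks (\<alpha> j)"
      by (simp add: z reflection_self linear_neg[OF linear_weyl_word])
    then have "- weyl_word \<alpha> ks (\<alpha> j) \<in> P" using assms(3)[OF j(1)] by simp
    then obtain ls where "length ks = Suc (length ls)" "set ls \<subseteq> set ks" "weyl_word \<alpha> ls = z"
      using exchange[of ks j] j assms(1) z \<open>j \<in> I\<close> by (metis subset_trans)
    then have "?Q ls" "length ls < length js" using j(2) snoc by auto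
    then show ?thesis using js(2)[of ls] by auto
  qed
qed

lemma min_repsD: "x \<in> min_reps \<alpha> I J \<Longrightarrow> x \<in> weyl \<alpha> I"
  by (simp add: min_reps_def)

text \<open>Otherwise \<open>x r\<^sub>j\<close> would be a shorter element of the same coset, by the exchange property.\<close>

lemma min_reps_positive:
  assumes "J \<subseteq> I" "x \<in> min_reps \<alpha> I J" "j \<in> J"
  shows "x (\<alpha> j) \<in> P"
proof (rule ccontr)
  have j: "j \<in> I" using assms by auto
  assume "x (\<alpha> j) \<notin> P"
  then have neg: "- x (\<alpha> j) \<in> P"
    using weyl_root[OF min_repsD[OF assms(2)] simple_root[OF j]] positive_or_negative by blast
  obtain js where js: "length js = weyl_length \<alpha> I x" "set js \<subseteq> I" "weyl_word \<alpha> js = x"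
    using min_repsD[OF assms(2)] by (rule reduced_wordE)
  obtain ks where ks: "length js = Suc (length ks)" "set ks \<subseteq> set js"
      "weyl_word \<alpha> ks = x \<circ> reflection (\<alpha> j)"
    using exchange[OF js(2) j] neg js(3) by auto
  have "x \<circ> reflection (\<alpha> j) \<in> weyl_coset \<alpha> J x"
    unfolding weyl_coset_def using simple_reflection_in_weyl[OF assms(3)] by blast
  then have "weyl_length \<alpha> I x \<le> weyl_length \<alpha> I (weyl_word \<alpha> ks)"
    using assms(2) ks(3) by (auto simp: min_reps_def)
  also have "\<dots> \<le> length ks" by (rule weyl_length_le) (use ks js in auto)
  finally show False using ks js by simp
qed

text \<open>
  Write \<open>y = x z\<close> with \<open>z \<in> W\<^sub>J\<close>. If \<open>z \<noteq> id\<close>, some \<open>z \<alpha>\<^sub>j\<close> with \<open>j \<in> J\<close> is negative, and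
  it is a combination of the \<open>\<alpha>\<^sub>i\<close> with \<open>i \<in> J\<close>. As \<open>x\<close> keeps those simple roots positive,
  \<open>y \<alpha>\<^sub>j = x (z \<alpha>\<^sub>j)\<close> is negative, against the positivity for \<open>y\<close>.
\<close>

lemma min_reps_unique:
  assumes "J \<subseteq> I" "x \<in> min_reps \<alpha> I J" "y \<in> min_reps \<alpha> I J" "y \<in> weyl_coset \<alpha> J x"
  shows "y = x"
proof -
  obtain z where z: "z \<in> weyl \<alpha> J" "y = x \<circ> z" using assms(4) by (auto simp: weyl_coset_def)
  have "z (\<alpha> j) \<in> P" if j: "j \<in> J" for j
  proof (rule ccontr)
    assume "z (\<alpha> j) \<notin> P"
    let ?b = "- z (\<alpha> j)"
    have root: "z (\<alpha> j) \<in> \<Phi>"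
      using weyl_root weyl_mono[OF assms(1) z(1)] simple_root j assms(1) by blast
    then have b: "?b \<in> P" using \<open>z (\<alpha> j) \<notin> P\<close> positive_or_negative by blast
    \<comment> \<open>\<open>W\<^sub>J\<close> fixes the dual vectors outside \<open>J\<close>, hence preserves the coefficients there.\<close>
    have outside: "dual k \<bullet> ?b = 0" if k: "k \<in> I - J" for k
    proof -
      have "dual k \<bullet> \<alpha> i = 0" if "i \<in> J" for i
        using dual_simple[of i k] that assms(1) k by auto
      then have "z (dual k) = dual k" by (rule weyl_fixes[OF z(1)])
      then have "dual k \<bullet> z (\<alpha> j) = dual k \<bullet> \<alpha> j" by (metis weyl_inner[OF z(1)])
      then show ?thesis using dual_simple j k assms(1) by auto
    qed
    note lin = linear_weyl[OF min_repsD[OF assms(2)]]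
    have "x ?b = (\<Sum>i\<in>I. (dual i \<bullet> ?b) *\<^sub>R x (\<alpha> i))"
      by (subst expansion) (simp only: linear_sum[OF lin] linear_scale[OF lin])
    then have "dual k \<bullet> x ?b = (\<Sum>i\<in>I. (dual i \<bullet> ?b) * (dual k \<bullet> x (\<alpha> i)))" for k
      by (simp only: inner_sum_right inner_scaleR_right)
    moreover have "(dual i \<bullet> ?b) * (dual k \<bullet> x (\<alpha> i)) \<ge> 0" if "k \<in> I" "i \<in> I" for i k
    proof (cases "i \<in> J")
      case True
      show ?thesis
        using dual_positive[OF b that(2)] dual_positive[OF min_reps_positive[OF assms(1,2) True] that(1)]
        by (rule mult_nonneg_nonneg)
    next
      case False
      then show ?thesis using outside that by simp
    qed
    ultimately have "dual k \<bullet> x ?b \<ge> 0" if "k \<in> I" for k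
      using that by (simp add: sum_nonneg del: inner_minus_right)
    moreover have "x ?b \<in> \<Phi>"
      using weyl_root[OF min_repsD[OF assms(2)]] positive_root[OF b] by blast
    ultimately have "x ?b \<in> P" by (intro positiveI_nonneg) auto
    then have "- y (\<alpha> j) \<in> P" by (simp add: z(2) linear_neg[OF lin])
    then show False
      using min_reps_positive[OF assms(1,3) j] not_positive_and_negative by blast
  qed
  then have "z = id" using positive_imp_id[OF assms(1) z(1)] by blast
  then show ?thesis using z by simp
qed

lemma min_rep_eq:
  assumes "J \<subseteq> I" "w \<in> weyl \<alpha> I" "x \<in> min_reps \<alpha> I J" "x \<in> weyl_coset \<alpha> J w"
  shows "min_rep \<alpha> I J w = x"
  unfolding min_rep_def
  using assms min_reps_unique weyl_coset_eq by (intro the_equality) blast+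

lemma min_rep_props:
  assumes "J \<subseteq> I" "w \<in> weyl \<alpha> I"
  shows "min_rep \<alpha> I J w \<in> min_reps \<alpha> I J" "min_rep \<alpha> I J w \<in> weyl_coset \<alpha> J w"
proof -
  obtain x where x: "x \<in> weyl_coset \<alpha> J w"
      "\<And>y. y \<in> weyl_coset \<alpha> J w \<Longrightarrow> weyl_length \<alpha> I x \<le> weyl_length \<alpha> I y"
    using ex_has_least_nat[of "\<lambda>y. y \<in> weyl_coset \<alpha> J w" w "weyl_length \<alpha> I"] self_in_weyl_coset
    by metis
  then have "x \<in> min_reps \<alpha> I J"
    unfolding min_reps_def using weyl_coset_in_weyl[OF assms] weyl_coset_eq[OF x(1)] by auto
  then show "min_rep \<alpha> I J w \<in> min_reps \<alpha> I J" "min_rep \<alpha> I J w \<in> weyl_coset \<alpha> J w"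
    using min_rep_eq[OF assms] x by auto
qed

lemma min_rep_cong:
  assumes "J \<subseteq> I" "w \<in> weyl \<alpha> I" "y \<in> weyl_coset \<alpha> J w"
  shows "min_rep \<alpha> I J y = min_rep \<alpha> I J w"
  unfolding min_rep_def using weyl_coset_eq[OF assms(3)] by simp

lemma min_rep_self:
  "J \<subseteq> I \<Longrightarrow> x \<in> min_reps \<alpha> I J \<Longrightarrow> min_rep \<alpha> I J x = x"
  by (simp add: min_rep_eq min_repsD self_in_weyl_coset)

section \<open>Reflections of the Weyl group, and finiteness\<close>

text \<open>
  Induction on the height. A positive root \<open>b\<close> supported on \<open>J\<close> has \<open>\<langle>b, \<alpha>\<^sub>i\<rangle> > 0\<close> for some
  \<open>i \<in> J\<close>, because \<open>\<langle>b, b\<rangle> > 0\<close>. Unless \<open>b = \<alpha>\<^sub>i\<close>, the root \<open>c = r\<^sub>i b\<close> is again positive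
  and supported on \<open>J\<close> but lower, and the reflection in \<open>b\<close> is the conjugate by \<open>r\<^sub>i\<close> of the
  reflection in \<open>c\<close>.
\<close>

lemma reflection_in_parabolic:
  assumes "J \<subseteq> I" "b \<in> \<Phi>" "\<And>k. k \<in> I - J \<Longrightarrow> dual k \<bullet> b = 0"
  shows "reflection b \<in> weyl \<alpha> J"
proof -
  \<comment> \<open>The counterexamples; one of least height is led to a contradiction.\<close>
  define C where "C = {b \<in> P. (\<forall>k\<in>I - J. dual k \<bullet> b = 0) \<and> reflection b \<notin> weyl \<alpha> J}"
  define ht where "ht b = (\<Sum>i\<in>I. dual i \<bullet> b)" for b
  have "C = {}"
  proof (rule ccontr)
    assume "C \<noteq> {}"
    moreover have "finite C"
      using finite_roots by (rule finite_subset[rotated]) (auto simp: C_def positive_root)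
    ultimately obtain b where b: "b \<in> C" "\<And>c. c \<in> C \<Longrightarrow> \<not> ht c < ht b"
      using ex_is_arg_min_if_finite[of C ht] by (auto simp: is_arg_min_def)
    have "b \<bullet> b > 0" using b(1) positive_root zero_not_root by (auto simp: C_def)
    moreover have "b \<bullet> b = (\<Sum>i\<in>I. (dual i \<bullet> b) * (\<alpha> i \<bullet> b))"
      by (subst (1) expansion) (simp add: inner_sum_left)
    ultimately have "\<not> (\<forall>i\<in>I. (dual i \<bullet> b) * (\<alpha> i \<bullet> b) \<le> 0)"
      using sum_nonpos[of I "\<lambda>i. (dual i \<bullet> b) * (\<alpha> i \<bullet> b)"] by auto
    then obtain i where i: "i \<in> I" "(dual i \<bullet> b) * (\<alpha> i \<bullet> b) > 0" by force
    have "dual i \<bullet> b \<ge> 0" using b(1) i dual_positive by (auto simp: C_def)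
    then have pos: "dual i \<bullet> b > 0" "b \<bullet> \<alpha> i > 0"
      using i(2) by (auto simp: zero_less_mult_iff inner_commute)
    then have iJ: "i \<in> J" using b(1) i(1) by (force simp: C_def)
    note refl = simple_reflection_in_weyl[OF iJ, of \<alpha>]
    let ?c = "reflection (\<alpha> i) b"
    have "b \<noteq> \<alpha> i" using b(1) refl by (auto simp: C_def)
    then have c: "?c \<in> P" using simple_reflection_positive[OF i(1)] b(1) by (auto simp: C_def)
    have "dual k \<bullet> ?c = 0" if "k \<in> I - J" for k
    proof -
      have "i \<noteq> k" using that iJ by auto
      then show ?thesis using dual_reflection[OF i(1)] that b(1) by (auto simp: C_def)
    qed
    moreover have "ht ?c < ht b"
    proof -
      have "\<alpha> i \<bullet> \<alpha> i > 0" using simple_root[OF i(1)] zero_not_root by auto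
      have "dual i \<bullet> ?c < dual i \<bullet> b"
        using pos \<open>\<alpha> i \<bullet> \<alpha> i > 0\<close> i(1) by (simp add: reflection_def inner_diff_right dual_simple)
      moreover have "dual k \<bullet> ?c \<le> dual k \<bullet> b" for k
        using calculation dual_reflection[OF i(1), of k b] by (cases "k = i") auto
      ultimately show ?thesis unfolding ht_def using i(1) finite_I by (intro sum_strict_mono_ex1) auto
    qed
    ultimately have "reflection ?c \<in> weyl \<alpha> J" using b(2) c by (auto simp: C_def)
    moreover have "reflection (\<alpha> i) \<circ> reflection b = reflection ?c \<circ> reflection (\<alpha> i)"
      by (rule reflection_conjugate) (auto simp: linear_reflection reflection_inner)
    then have "reflection b = reflection (\<alpha> i) \<circ> reflection ?c \<circ> reflection (\<alpha> i)"
      by (metis comp_assoc id_comp reflection_comp_self)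
    ultimately have "reflection b \<in> weyl \<alpha> J" using refl by (metis weyl_comp)
    then show False using b(1) by (auto simp: C_def)
  qed
  then have *: "reflection b \<in> weyl \<alpha> J" if "b \<in> P" "\<And>k. k \<in> I - J \<Longrightarrow> dual k \<bullet> b = 0" for b
    using that by (auto simp: C_def)
  show ?thesis
    using positive_or_negative[OF assms(2)] *[of b] *[of "- b"] assms(3) by auto
qed

text \<open>The roots span, so an element of \<open>W\<close> is determined by its permutation of them.\<close>

lemma finite_weyl: "finite (weyl \<alpha> I)"
proof (rule inj_on_finite)
  show "inj_on (\<lambda>w. restrict w \<Phi>) (weyl \<alpha> I)"
  proof (rule inj_onI)
    fix v w assume vw: "v \<in> weyl \<alpha> I" "w \<in> weyl \<alpha> I" "restrict v \<Phi> = restrict w \<Phi>"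
    have "v x = w x" for x
    proof (rule linear_eq_on_span[of v w \<Phi>])
      show "x \<in> span \<Phi>" using root_system by (simp add: root_system_def)
      show "\<And>y. y \<in> \<Phi> \<Longrightarrow> v y = w y" using vw(3) by (metis restrict_apply')
    qed (use vw linear_weyl in auto)
    then show "v = w" by auto
  qed
  show "(\<lambda>w. restrict w \<Phi>) ` weyl \<alpha> I \<subseteq> \<Phi> \<rightarrow>\<^sub>E \<Phi>" using weyl_root by auto
  show "finite (\<Phi> \<rightarrow>\<^sub>E \<Phi>)" using finite_roots by (simp add: finite_PiE)
qed

section \<open>A dominant weight for the parabolic subgroup\<close>

text \<open>
  A dominant vector whose stabilizer is \<open>W\<^sub>J\<close>. The lemmas \<open>weight_pos\<close> and \<open>weight_zero\<close>
  translate the position of a root relative to \<open>\<Phi>\<^sub>J\<close> into the sign of its inner product with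
  this vector.
\<close>

definition weight :: "'i set \<Rightarrow> 'a" where
  "weight J = (\<Sum>i\<in>I - J. dual i)"

lemma weight_simple: "j \<in> I \<Longrightarrow> j \<in> J \<Longrightarrow> weight J \<bullet> \<alpha> j = 0"
  by (auto simp: weight_def inner_sum_left dual_simple intro!: sum.neutral)

lemma weight_pos:
  assumes "J \<subseteq> I" "b \<in> \<Phi>" "weight J \<bullet> b > 0"
  shows "b \<in> P - positive_roots_sub \<Phi> I \<alpha> J"
proof -
  have "\<not> (\<forall>i\<in>I - J. dual i \<bullet> b \<le> 0)"
    using assms(3) sum_nonpos[of "I - J" "\<lambda>i. dual i \<bullet> b"] by (auto simp: weight_def inner_sum_left)
  then have "b \<in> P" using positiveI assms(2) by force
  moreover have "b \<notin> span (\<alpha> ` J)"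
  proof
    assume "b \<in> span (\<alpha> ` J)"
    then have "orthogonal (weight J) b"
      by (rule orthogonal_to_span)
         (use weight_simple assms(1) in \<open>auto simp: orthogonal_def\<close>)
    then show False using assms(3) by (simp add: orthogonal_def)
  qed
  ultimately show ?thesis by (simp add: positive_roots_sub_def)
qed

lemma weight_zero:
  assumes "b \<in> \<Phi>" "weight J \<bullet> b = 0" "k \<in> I - J"
  shows "dual k \<bullet> b = 0"
proof -
  have *: "dual k \<bullet> c = 0" if "c \<in> P" "weight J \<bullet> c = 0" for c
  proof -
    have "(\<Sum>i\<in>I - J. dual i \<bullet> c) = 0" using that(2) by (simp add: weight_def inner_sum_left)
    then show ?thesis
      using sum_nonneg_eq_0_iff[of "I - J" "\<lambda>i. dual i \<bullet> c"] finite_I dual_positive[OF that(1)] assms(3)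
      by auto
  qed
  show ?thesis using positive_or_negative[OF assms(1)] *[of b] *[of "- b"] assms(2) by auto
qed

end

section \<open>Averaging over a set closed under the steps\<close>

text \<open>
  The elements that the involution \<open>T\<close> keeps in \<open>S\<close> contribute nothing to the sum, because \<open>f\<close>
  changes sign along \<open>T\<close>. The elements that leave \<open>S\<close> have \<open>f \<le> 0\<close>. If the sum vanishes, \<open>f\<close>
  must vanish at all elements that leave.
\<close>

lemma involution_sum:
  fixes f :: "'b \<Rightarrow> real"
  assumes "finite S" and T: "\<And>x. x \<in> S \<Longrightarrow> T (T x) = x" and f: "\<And>x. x \<in> S \<Longrightarrow> f (T x) = - f x"
    and closed: "\<And>x. x \<in> S \<Longrightarrow> f x > 0 \<Longrightarrow> T x \<in> S"
  shows "sum f S \<le> 0" and "sum f S = 0 \<Longrightarrow> x \<in> S \<Longrightarrow> f x \<noteq> 0 \<Longrightarrow> T x \<in> S"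
proof -
  define A where "A = {x \<in> S. T x \<in> S}"
  have "sum f A = (\<Sum>x\<in>A. - f x)"
    by (rule sum.reindex_bij_witness[of _ T T]) (auto simp: A_def T f)
  then have "sum f A = 0" by (simp add: sum_negf)
  then have sum: "sum f S = sum f (S - A)"
    using sum.subset_diff[of A S f] assms(1) by (auto simp: A_def)
  have le: "f x \<le> 0" if "x \<in> S - A" for x using that closed[of x] by (force simp: A_def)
  show "sum f S \<le> 0" unfolding sum by (rule sum_nonpos) (rule le)
  show "T x \<in> S" if "sum f S = 0" "x \<in> S" "f x \<noteq> 0"
  proof (rule ccontr)
    assume "T x \<notin> S"
    then have "x \<in> S - A" using that by (auto simp: A_def)
    moreover have "\<forall>x\<in>S - A. - f x = 0"
      using that(1) sum assms(1) le
      by (subst sum_nonneg_eq_0_iff[symmetric]) (auto simp: sum_negf)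
    ultimately show False using that(3) by auto
  qed
qed

lemma affine_reflection_eq: "affine_reflection \<alpha> \<theta> p = reflection (affine_root \<alpha> \<theta> p)"
  by (simp add: affine_reflection_def affine_root_def split: option.split)

context based_root_system
begin

lemma affine_root_in_roots:
  "highest_root \<Phi> I \<alpha> \<theta> \<Longrightarrow> p \<in> affine_nodes I \<Longrightarrow> affine_root \<alpha> \<theta> p \<in> \<Phi>"
  by (auto simp: affine_nodes_def affine_root_def simple_root uminus_root highest_root_def)

lemma affine_reflection_in_weyl:
  "highest_root \<Phi> I \<alpha> \<theta> \<Longrightarrow> p \<in> affine_nodes I \<Longrightarrow> affine_reflection \<alpha> \<theta> p \<in> weyl \<alpha> I"
  unfolding affine_reflection_eq by (rule reflection_in_parabolic) (auto simp: affine_root_in_roots)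

text \<open>
  A nonempty set of representatives that no step can leave is everything. Only the steps with
  strictly positive pairing against the weight are asked to stay inside; the averaging argument
  supplies the reverse steps.
\<close>

lemma out_closed_eq_all:
  assumes "J \<subseteq> I" "highest_root \<Phi> I \<alpha> \<theta>"
    and S: "S \<subseteq> min_reps \<alpha> I J" "u \<in> S"
    and closed: "\<And>x p. x \<in> S \<Longrightarrow> p \<in> affine_nodes I \<Longrightarrow> x (weight J) \<bullet> affine_root \<alpha> \<theta> p > 0
                   \<Longrightarrow> min_rep \<alpha> I J (affine_reflection \<alpha> \<theta> p \<circ> x) \<in> S"
  shows "S = min_reps \<alpha> I J"
proof -
  let ?s = "affine_reflection \<alpha> \<theta>" and ?a = "affine_root \<alpha> \<theta>" and ?l = "weight J"
  define T where "T p x = min_rep \<alpha> I J (?s p \<circ> x)" for p x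
  note s_eq = affine_reflection_eq[of \<alpha> \<theta>]
  note a = affine_root_in_roots[OF assms(2)] and sW = affine_reflection_in_weyl[OF assms(2)]
  have TW: "?s p \<circ> x \<in> weyl \<alpha> I" if "p \<in> affine_nodes I" "x \<in> min_reps \<alpha> I J" for p x
    using sW that min_repsD weyl_comp by blast
  have T_coset: "T p x \<in> weyl_coset \<alpha> J (?s p \<circ> x)"
    if "p \<in> affine_nodes I" "x \<in> min_reps \<alpha> I J" for p x
    unfolding T_def by (rule min_rep_props(2)[OF assms(1) TW[OF that]])
  have fin: "finite S"
    using finite_weyl S(1) min_repsD by (metis finite_subset subsetI)
  have weight_fixed: "z ?l = ?l" if "z \<in> weyl \<alpha> J" for z
    using weyl_fixes[OF that, of ?l] weight_simple assms(1) by auto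
  have T_invol: "T p (T p x) = x" if "p \<in> affine_nodes I" "x \<in> min_reps \<alpha> I J" for p x
  proof -
    have "?s p \<circ> T p x \<in> weyl_coset \<alpha> J (?s p \<circ> (?s p \<circ> x))"
      using T_coset[OF that] by (rule weyl_coset_left_mult)
    also have "?s p \<circ> (?s p \<circ> x) = x" by (simp add: s_eq comp_assoc[symmetric])
    finally have "min_rep \<alpha> I J (?s p \<circ> T p x) = min_rep \<alpha> I J x"
      using min_rep_cong[OF assms(1)] min_repsD that by blast
    then show ?thesis using min_rep_self[OF assms(1) that(2)] unfolding T_def by simp
  qed
  have T_weight: "T p x ?l = ?s p (x ?l)" if "p \<in> affine_nodes I" "x \<in> min_reps \<alpha> I J" for p x
  proof -
    from T_coset[OF that] obtain z where "z \<in> weyl \<alpha> J" "T p x = ?s p \<circ> x \<circ> z"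
      by (auto simp: weyl_coset_def)
    then show ?thesis using weight_fixed[of z] by simp
  qed
  have T_neg: "T p x ?l \<bullet> ?a p = - (x ?l \<bullet> ?a p)"
    if "p \<in> affine_nodes I" "x \<in> min_reps \<alpha> I J" for p x
  proof -
    have "?a p \<noteq> 0" using a[OF that(1)] zero_not_root by metis
    then show ?thesis
      by (simp add: T_weight[OF that] s_eq reflection_inner_swap reflection_self)
  qed
  have sum_le: "(\<Sum>x\<in>S. x ?l \<bullet> ?a p) \<le> 0" if "p \<in> affine_nodes I" for p
    by (rule involution_sum[of S "T p"])
       (use that S(1) fin T_invol T_neg closed in \<open>auto simp: T_def[symmetric]\<close>)
  define \<sigma> where "\<sigma> = (\<Sum>x\<in>S. x ?l)"
  have \<sigma>_le: "\<sigma> \<bullet> ?a p \<le> 0" if "p \<in> affine_nodes I" for p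
    using sum_le[OF that] by (simp add: \<sigma>_def inner_sum_left)
  have \<sigma>_simple: "\<sigma> \<bullet> \<alpha> i \<le> 0" if "i \<in> I" for i
    using \<sigma>_le[of "Some i"] that by (simp add: affine_nodes_def affine_root_def)
  \<comment> \<open>The coefficients of \<open>\<theta>\<close> are positive because \<open>\<theta>\<close> dominates every simple root.\<close>
  have coeff: "dual i \<bullet> \<theta> \<ge> 1" if "i \<in> I" for i
  proof -
    have "\<theta> - \<alpha> i \<in> root_cone I \<alpha>"
      using assms(2) simple_root[OF that] by (simp add: highest_root_def)
    from dual_cone[OF this that] show ?thesis by (simp add: inner_diff_right dual_simple that)
  qed
  \<comment> \<open>The affine node gives \<open>\<sigma> \<bullet> \<theta> \<ge> 0\<close>, although all summands in its expansion are \<open>\<le> 0\<close>.\<close>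
  have \<sigma>_zero: "\<sigma> \<bullet> \<alpha> i = 0" if "i \<in> I" for i
  proof -
    have "0 \<le> \<sigma> \<bullet> \<theta>" using \<sigma>_le[of None] by (simp add: affine_nodes_def affine_root_def)
    also have "\<sigma> \<bullet> \<theta> = (\<Sum>i\<in>I. (dual i \<bullet> \<theta>) * (\<sigma> \<bullet> \<alpha> i))"
      by (subst expansion[of \<theta>]) (simp add: inner_sum_right)
    finally have "(\<Sum>i\<in>I. (dual i \<bullet> \<theta>) * - (\<sigma> \<bullet> \<alpha> i)) \<le> 0" by (simp add: sum_negf)
    moreover have nonneg: "(dual i \<bullet> \<theta>) * - (\<sigma> \<bullet> \<alpha> i) \<ge> 0" if "i \<in> I" for i
      using coeff[OF that] \<sigma>_simple[OF that] by (intro mult_nonneg_nonneg) auto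
    ultimately have "(\<Sum>i\<in>I. (dual i \<bullet> \<theta>) * - (\<sigma> \<bullet> \<alpha> i)) = 0"
      by (meson antisym sum_nonneg)
    then have "(dual i \<bullet> \<theta>) * - (\<sigma> \<bullet> \<alpha> i) = 0"
      using sum_nonneg_eq_0_iff[OF finite_I, of "\<lambda>i. (dual i \<bullet> \<theta>) * - (\<sigma> \<bullet> \<alpha> i)"] nonneg that by blast
    then show ?thesis using coeff[OF that] by auto
  qed
  have T_closed: "T (Some i) x \<in> S" if i: "i \<in> I" and x: "x \<in> S" for i x
  proof (cases "x ?l \<bullet> \<alpha> i = 0")
    case True
    \<comment> \<open>Here \<open>s\<^sub>i x = x r\<^sub>b\<close> with \<open>b = x\<^sup>-\<^sup>1 \<alpha>\<^sub>i\<close> in \<open>\<Phi>\<^sub>J\<close>, so the step stays in the coset of \<open>x\<close>.\<close>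
    have xm: "x \<in> min_reps \<alpha> I J" and xW: "x \<in> weyl \<alpha> I" using x S(1) min_repsD by auto
    let ?b = "inv_into UNIV x (\<alpha> i)"
    have xb: "x ?b = \<alpha> i" using bij_weyl[OF xW] by (simp add: bij_is_surj surj_f_inv_f)
    have "?l \<bullet> ?b = x ?l \<bullet> x ?b" by (simp add: weyl_inner[OF xW])
    then have "?l \<bullet> ?b = 0" using True xb by simp
    moreover have "?b \<in> \<Phi>" using weyl_root inv_in_weyl[OF xW] simple_root[OF i] by blast
    ultimately have "reflection ?b \<in> weyl \<alpha> J"
      using reflection_in_parabolic[OF assms(1)] weight_zero by blast
    moreover have "x \<circ> reflection ?b = reflection (\<alpha> i) \<circ> x"
      using reflection_conjugate[OF linear_weyl[OF xW] weyl_inner[OF xW], of ?b] xb by simp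
    ultimately have "?s (Some i) \<circ> x \<in> weyl_coset \<alpha> J x"
      unfolding weyl_coset_def affine_reflection_def option.case by (metis image_eqI)
    then have "T (Some i) x = x"
      unfolding T_def using min_rep_cong[OF assms(1) xW] min_rep_self[OF assms(1) xm] by simp
    then show ?thesis using x by simp
  next
    case False
    have p: "Some i \<in> affine_nodes I" "?a (Some i) = \<alpha> i"
      using i by (auto simp: affine_nodes_def affine_root_def)
    show ?thesis
    proof (rule involution_sum(2)[of S "T (Some i)" "\<lambda>x. x ?l \<bullet> \<alpha> i"])
      show "(\<Sum>x\<in>S. x ?l \<bullet> \<alpha> i) = 0" using \<sigma>_zero[OF i] by (simp add: \<sigma>_def inner_sum_left)
    qed (use p S(1) fin T_invol T_neg[OF p(1)] closed[OF _ p(1)] x False in \<open>auto simp: T_def\<close>)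
  qed
  have uW: "u \<in> weyl \<alpha> I" using S min_repsD by auto
  \<comment> \<open>\<open>T\<close> describes left multiplication on cosets, so words in the simple reflections act on \<open>S\<close>.\<close>
  have words: "min_rep \<alpha> I J (weyl_word \<alpha> js \<circ> u) \<in> S" if "set js \<subseteq> I" for js
    using that
  proof (induction js)
    case Nil
    then show ?case using S min_rep_self[OF assms(1), of u] by auto
  next
    case (Cons i js)
    let ?w = "weyl_word \<alpha> js \<circ> u"
    have i: "i \<in> I" "set js \<subseteq> I" using Cons.prems by auto
    have wW: "?w \<in> weyl \<alpha> I" by (rule weyl_comp[OF weyl_word_in_weyl[OF i(2)] uW])
    have iW: "reflection (\<alpha> i) \<circ> ?w \<in> weyl \<alpha> I"
      by (rule weyl_comp[OF simple_reflection_in_weyl[OF i(1)] wW])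
    have "T (Some i) (min_rep \<alpha> I J ?w) = min_rep \<alpha> I J (reflection (\<alpha> i) \<circ> ?w)"
      unfolding T_def affine_reflection_def option.case
      by (rule min_rep_cong[OF assms(1) iW])
         (rule weyl_coset_left_mult[OF min_rep_props(2)[OF assms(1) wW]])
    then show ?case
      using T_closed[OF i(1) Cons.IH[OF i(2)]] by (simp only: comp_assoc weyl_word_Cons)
  qed
  have "v \<in> S" if v: "v \<in> min_reps \<alpha> I J" for v
  proof -
    have "v \<circ> inv_into UNIV u \<in> weyl \<alpha> I" using min_repsD[OF v] inv_in_weyl[OF uW] weyl_comp by blast
    then obtain js where js: "set js \<subseteq> I" "v \<circ> inv_into UNIV u = weyl_word \<alpha> js" by (rule weylE)
    then have "weyl_word \<alpha> js \<circ> u = v"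
      using weyl_comp_inv(2)[OF uW] by (metis comp_assoc comp_id)
    then show ?thesis using words[OF js(1)] min_rep_self[OF assms(1) v] by simp
  qed
  then show ?thesis using S(1) by auto
qed

end

theorem lemma6p12:
  fixes \<Phi> :: "'a::euclidean_space set" and I J :: "'i set"
    and \<alpha> :: "'i \<Rightarrow> 'a" and \<theta> :: 'a and u v :: "'a \<Rightarrow> 'a"
  assumes "irreducible_root_system \<Phi>"
    and "simple_roots \<Phi> I \<alpha>"
    and "highest_root \<Phi> I \<alpha> \<theta>"
    and "J \<subseteq> I"
    and "u \<in> min_reps \<alpha> I J" and "v \<in> min_reps \<alpha> I J"
  shows "\<exists>(n::nat) (x :: nat \<Rightarrow> 'a \<Rightarrow> 'a) (p :: nat \<Rightarrow> 'i option).
           x 0 = u \<and> x n = v \<and>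
           (\<forall>k\<le>n. x k \<in> min_reps \<alpha> I J) \<and>
           (\<forall>k\<in>{1..n}. p k \<in> affine_nodes I) \<and>
           (\<forall>k<n. x (k + 1) = min_rep \<alpha> I J (affine_reflection \<alpha> \<theta> (p (k + 1)) \<circ> x k) \<and>
                  inv_into UNIV (x k) (affine_root \<alpha> \<theta> (p (k + 1)))
                    \<in> positive_roots \<Phi> I \<alpha> - positive_roots_sub \<Phi> I \<alpha> J)"
proof -
  interpret based_root_system \<Phi> I \<alpha>
    using assms(1,2) by unfold_locales (auto simp: irreducible_root_system_def)
  let ?edge = "\<lambda>p x y. p \<in> affine_nodes I \<and> x \<in> min_reps \<alpha> I J \<and> y \<in> min_reps \<alpha> I J \<and>
      y = min_rep \<alpha> I J (affine_reflection \<alpha> \<theta> p \<circ> x) \<and>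
      inv_into UNIV x (affine_root \<alpha> \<theta> p) \<in> P - positive_roots_sub \<Phi> I \<alpha> J"
  define E where "E x y \<longleftrightarrow> (\<exists>p. ?edge p x y)" for x y
  have edge: "E x (min_rep \<alpha> I J (affine_reflection \<alpha> \<theta> p \<circ> x))"
    if x: "x \<in> min_reps \<alpha> I J" and p: "p \<in> affine_nodes I"
      and pos: "x (weight J) \<bullet> affine_root \<alpha> \<theta> p > 0" for x p
  proof -
    have xW: "x \<in> weyl \<alpha> I" using x by (rule min_repsD)
    have a: "affine_root \<alpha> \<theta> p \<in> \<Phi>" using affine_root_in_roots[OF assms(3) p] .
    have "affine_reflection \<alpha> \<theta> p \<in> weyl \<alpha> I"
      using affine_reflection_in_weyl[OF assms(3) p] .
    then have "min_rep \<alpha> I J (affine_reflection \<alpha> \<theta> p \<circ> x) \<in> min_reps \<alpha> I J"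
      using min_rep_props(1)[OF assms(4)] xW weyl_comp by blast
    moreover have "inv_into UNIV x (affine_root \<alpha> \<theta> p) \<in> P - positive_roots_sub \<Phi> I \<alpha> J"
    proof (rule weight_pos[OF assms(4)])
      show "inv_into UNIV x (affine_root \<alpha> \<theta> p) \<in> \<Phi>" using weyl_root inv_in_weyl[OF xW] a by blast
      have "x (inv_into UNIV x (affine_root \<alpha> \<theta> p)) = affine_root \<alpha> \<theta> p"
        using bij_weyl[OF xW] by (simp add: bij_is_surj surj_f_inv_f)
      then show "weight J \<bullet> inv_into UNIV x (affine_root \<alpha> \<theta> p) > 0"
        using pos weyl_inner[OF xW] by metis
    qed
    ultimately show ?thesis unfolding E_def using x p by blast
  qed
  have min: "y \<in> min_reps \<alpha> I J" if "E\<^sup>*\<^sup>* u y" for y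
    using that assms(5) by (cases rule: rtranclp.cases) (auto simp: E_def)
  have "{y. E\<^sup>*\<^sup>* u y} = min_reps \<alpha> I J"
  proof (rule out_closed_eq_all[OF assms(4,3)])
    fix x p assume "x \<in> {y. E\<^sup>*\<^sup>* u y}" "p \<in> affine_nodes I" "x (weight J) \<bullet> affine_root \<alpha> \<theta> p > 0"
    then show "min_rep \<alpha> I J (affine_reflection \<alpha> \<theta> p \<circ> x) \<in> {y. E\<^sup>*\<^sup>* u y}"
      using edge[of x p] min[of x] by (auto intro: rtranclp.rtrancl_into_rtrancl)
  qed (use min in auto)
  then have "E\<^sup>*\<^sup>* u v" using assms(6) by blast
  then obtain n where "(E ^^ n) u v" by (auto dest: rtranclp_imp_relpowp)
  then obtain x where x: "x 0 = u" "x n = v" "\<And>k. k < n \<Longrightarrow> E (x k) (x (Suc k))"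
    by (auto simp: relpowp_fun_conv)
  then have "\<forall>k. \<exists>p. k < n \<longrightarrow> ?edge p (x k) (x (Suc k))" by (auto simp: E_def)
  then obtain q where q: "\<And>k. k < n \<Longrightarrow> ?edge (q k) (x k) (x (Suc k))" by metis
  \<comment> \<open>The label of the step from \<open>x k\<close> to \<open>x (k + 1)\<close> carries the index \<open>k + 1\<close>, hence the shift.\<close>
  have "x k \<in> min_reps \<alpha> I J" if "k \<le> n" for k
    using that q[of k] x(2) assms(6) by (cases "k = n") auto
  moreover have "q (k - 1) \<in> affine_nodes I" if "k \<in> {1..n}" for k
    using that q[of "k - 1"] by auto
  ultimately show ?thesis
    using x(1,2) q by (intro exI[of _ n] exI[of _ x] exI[of _ "\<lambda>k. q (k - 1)"]) auto
qed

end
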